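(* Let $\mathbf r\in\mathcal R$, let $\tau$ be defined by $\tau=2$ if $r_1=1$ and $\ell<\sigma_3-\sigma_1$, and $\tau=1$ otherwise, and let $\vartheta:=\sigma_1/r_3+\ell\sigma_3/r_3^2$; then $\vartheta$ is an integer with $\vartheta\ge2$. For integers $t$ with $0\le t<\tau$ write $m=U_{\mathbf r}(t)=g_1g_2g_3$ with $g_\nu=r_\nu(\sigma_3t+\ell)+1$. Then: (i) If each $g_\nu$ is an odd prime, then $m$ is a Carmichael number with exactly three prime factors; additionally $m\in\mathcal C'_3$ if $t=0$ and $m\in\mathcal S$, while $m\notin\mathcal C'_3$ if $t=1$. (ii) If $t=0$: if $\vartheta=2$ then $s_{g_3}(m)<g_3$, $m=g_3^2$ and $g_3=g_1g_2$; if $\vartheta>2$ then $s_{g_3}(m)=g_3$ and $m>g_3^2$. (iii) If $t=1$, then $m\in\mathcal S'$ and $g_1\cdot g_2\cdot g_3$ is an $s$-decomposition of $m$ which is not strict, with $s_{g_1}(m)=2g_1-1$, $s_{g_2}(m)=g_2$, $s_{g_3}(m)=g_3$.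
   Context: $\mathcal R$ is the set of triples $\mathbf r=(r_1,r_2,r_3)$ of pairwise coprime positive integers with $r_1<r_2<r_3$. For $\mathbf r\in\mathcal R$ put $\sigma_1=r_1+r_2+r_3$, $\sigma_2=r_1r_2+r_1r_3+r_2r_3$, $\sigma_3=r_1r_2r_3$, and let $\ell$ be the unique integer with $0\le\ell<\sigma_3$ and $\ell\sigma_2\equiv-\sigma_1\pmod{\sigma_3}$. Define $U_{\mathbf r}(t)=\prod_{\nu=1}^3(r_\nu(\sigma_3t+\ell)+1)$. For an integer base $g\ge2$ and $m\ge0$, $s_g(m)$ is the sum of base-$g$ digits of $m$, and $s_1(m):=0$. A Carmichael number is a composite positive $m$ with $a^{m-1}\equiv1\pmod m$ for all $a$ coprime to $m$. An $s$-decomposition of a positive integer $m$ is a factorization $m=\prod_{\nu=1}^n g_\nu^{e_\nu}$, $e_\nu\ge1$, with proper factors $1<g_\nu<m$, $g_1<\dots<g_n$ (not necessarily coprime), and $s_{g_\nu}(m)\ge g_\nu$ for all $\nu$; it is strict if $s_{g_\nu}(m)=g_\nu$ for all $\nu$. $\mathcal S'$ (resp. $\mathcal S$) is the set of positive integers admitting an $s$-decomposition (resp. strict one). $\mathcal C'_3$ is the set of squarefree $m>1$ with exactly three prime factors and $s_p(m)=p$ for every prime $p\mid m$. *)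

theory Defs
  imports "HOL-Number_Theory.Number_Theory" "HOL-Computational_Algebra.Squarefree"
begin

(* Equal to 0 for the degenerate bases 0 and 1, so the convention s_1(m) = 0 is built in. *)
fun digit_sum :: "nat \<Rightarrow> nat \<Rightarrow> nat" where
  "digit_sum g m = (if g \<le> 1 \<or> m = 0 then 0 else m mod g + digit_sum g (m div g))"

declare digit_sum.simps [simp del]

definition carmichael_number :: "nat \<Rightarrow> bool" where
  "carmichael_number m \<longleftrightarrow>
     m > 1 \<and> \<not> prime m \<and>
     (\<forall>a::int. coprime a (int m) \<longrightarrow> [a ^ (m - 1) = 1] (mod (int m)))"

(* A decomposition g_1^e_1 * ... * g_n^e_n is the nonempty list [(g_1, e_1), ..., (g_n, e_n)]. *)
definition factor_decomposition :: "(nat \<times> nat) list \<Rightarrow> nat \<Rightarrow> bool" where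
  "factor_decomposition D m \<longleftrightarrow>
     D \<noteq> [] \<and> m = (\<Prod>(g, e)\<leftarrow>D. g ^ e) \<and>
     sorted_wrt (<) (map fst D) \<and>
     (\<forall>(g, e) \<in> set D. 1 < g \<and> g < m \<and> e \<ge> 1)"

definition s_decomposition :: "(nat \<times> nat) list \<Rightarrow> nat \<Rightarrow> bool" where
  "s_decomposition D m \<longleftrightarrow>
     factor_decomposition D m \<and> (\<forall>(g, e) \<in> set D. digit_sum g m \<ge> g)"

definition strict_s_decomposition :: "(nat \<times> nat) list \<Rightarrow> nat \<Rightarrow> bool" where
  "strict_s_decomposition D m \<longleftrightarrow>
     s_decomposition D m \<and> (\<forall>(g, e) \<in> set D. digit_sum g m = g)"

definition S_weak :: "nat set" where
  "S_weak = {m. m > 0 \<and> (\<exists>D. s_decomposition D m)}"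

definition S_strict :: "nat set" where
  "S_strict = {m. m > 0 \<and> (\<exists>D. strict_s_decomposition D m)}"

definition primary_carmichael3 :: "nat set" where
  "primary_carmichael3 =
     {m. m > 1 \<and> squarefree m \<and> card (prime_factors m) = 3 \<and>
         (\<forall>p. prime p \<and> p dvd m \<longrightarrow> digit_sum p m = p)}"

definition coprime_triples :: "(nat \<times> nat \<times> nat) set" where
  "coprime_triples =
     {(r1, r2, r3). 0 < r1 \<and> r1 < r2 \<and> r2 < r3 \<and>
        coprime r1 r2 \<and> coprime r1 r3 \<and> coprime r2 r3}"

fun sigma1 :: "nat \<times> nat \<times> nat \<Rightarrow> nat" where
  "sigma1 (r1, r2, r3) = r1 + r2 + r3"

fun sigma2 :: "nat \<times> nat \<times> nat \<Rightarrow> nat" where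
  "sigma2 (r1, r2, r3) = r1 * r2 + r1 * r3 + r2 * r3"

fun sigma3 :: "nat \<times> nat \<times> nat \<Rightarrow> nat" where
  "sigma3 (r1, r2, r3) = r1 * r2 * r3"

definition ell :: "nat \<times> nat \<times> nat \<Rightarrow> nat" where
  "ell r = (THE l. l < sigma3 r \<and>
     [int l * int (sigma2 r) = - int (sigma1 r)] (mod (int (sigma3 r))))"

lemma coprime_sigma2_sigma3:
  assumes "r \<in> coprime_triples"
  shows "coprime (sigma2 r) (sigma3 r)"
proof -
  obtain a b c where r: "r = (a, b, c)" by (cases r) auto
  have co: "coprime a b" "coprime a c" "coprime b c"
    using assms by (auto simp: r coprime_triples_def)
  have aux: "coprime (k * x + y) x" if "coprime y x" for k x y :: nat
    using that by (metis coprime_iff_gcd_eq_1 gcd.commute gcd_add_mult add.commute)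
  have "coprime ((b + c) * a + b * c) a" "coprime ((a + c) * b + a * c) b"
       "coprime ((a + b) * c + a * b) c"
    using co by (intro aux; simp add: coprime_commute)+
  then show ?thesis
    by (simp add: r algebra_simps)
qed

lemma ell_unique_exists:
  assumes "r \<in> coprime_triples"
  shows "\<exists>!l. l < sigma3 r \<and>
     [int l * int (sigma2 r) = - int (sigma1 r)] (mod (int (sigma3 r)))"
proof -
  define s1 s2 s3 where "s1 = int (sigma1 r)" and "s2 = int (sigma2 r)" and "s3 = int (sigma3 r)"
  have pos: "s3 > 0"
    using assms by (cases r) (auto simp: s3_def coprime_triples_def)
  have co: "coprime s2 s3"
    using coprime_sigma2_sigma3[OF assms] by (simp add: s2_def s3_def)
  obtain x where x: "[s2 * x = 1] (mod s3)"
    using cong_solve_coprime_int[OF co] by auto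
  define y where "y = (- s1 * x) mod s3"
  have y: "0 \<le> y" "y < s3"
    using pos by (auto simp: y_def)
  have "[y * s2 = (- s1 * x) * s2] (mod s3)"
    by (intro cong_mult) (auto simp: y_def cong_def)
  also have "(- s1 * x) * s2 = - s1 * (s2 * x)" by simp
  also have "[- s1 * (s2 * x) = - s1 * 1] (mod s3)"
    using x by (intro cong_mult) auto
  finally have sol: "[y * s2 = - s1] (mod s3)" by simp
  show ?thesis
  proof (rule ex1I[of _ "nat y"])
    show "nat y < sigma3 r \<and>
      [int (nat y) * int (sigma2 r) = - int (sigma1 r)] (mod (int (sigma3 r)))"
      using y sol by (auto simp: s1_def s2_def s3_def)
  next
    fix l assume l: "l < sigma3 r \<and>
      [int l * int (sigma2 r) = - int (sigma1 r)] (mod (int (sigma3 r)))"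
    then have "[int l * s2 = y * s2] (mod s3)"
      using sol by (auto simp: s1_def s2_def s3_def cong_def)
    then have "[int l = y] (mod s3)"
      using co cong_mult_rcancel by blast
    moreover have "int l < s3"
      using l by (simp add: s3_def)
    ultimately have "int l = y"
      using y by (auto simp: cong_def)
    then show "l = nat y" by simp
  qed
qed

definition U_factor :: "nat \<times> nat \<times> nat \<Rightarrow> nat \<Rightarrow> nat \<Rightarrow> nat" where
  "U_factor r x t = x * (sigma3 r * t + ell r) + 1"

fun U :: "nat \<times> nat \<times> nat \<Rightarrow> nat \<Rightarrow> nat" where
  "U (r1, r2, r3) t =
     U_factor (r1, r2, r3) r1 t * U_factor (r1, r2, r3) r2 t * U_factor (r1, r2, r3) r3 t"

fun tau :: "nat \<times> nat \<times> nat \<Rightarrow> nat" where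
  "tau (r1, r2, r3) =
     (if r1 = 1 \<and> int (ell (r1, r2, r3)) < int (sigma3 (r1, r2, r3)) - int (sigma1 (r1, r2, r3))
      then 2 else 1)"

fun theta :: "nat \<times> nat \<times> nat \<Rightarrow> rat" where
  "theta (r1, r2, r3) =
     of_nat (sigma1 (r1, r2, r3)) / of_nat r3
     + of_nat (ell (r1, r2, r3)) * of_nat (sigma3 (r1, r2, r3)) / (of_nat r3)\<^sup>2"

end

theory Submission
  imports Defs
begin

text \<open>With \<open>x = \<sigma>\<^sub>3 t + \<ell>\<close> and \<open>{a, b, c}\<close> the triple, \<open>\<sigma>\<^sub>3\<close> divides \<open>\<sigma>\<^sub>1 + x \<sigma>\<^sub>2\<close>, so
  \<open>a + b + x a b = k c\<close> for some \<open>k\<close>, and \<open>g = c x + 1\<close> satisfies \<open>m = g (k (g - 1) + 1)\<close>.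
  Dividing \<open>k - 1 = u g + v\<close> turns the cofactor into \<open>u g\<^sup>2 + (v - u) g + (g - v)\<close>: for \<open>0 < v\<close>
  and \<open>u \<le> v\<close> these are base-\<open>g\<close> digits with sum \<open>g\<close>, while \<open>u > v\<close> forces one borrow, which
  adds \<open>g - 1\<close>. The largest factor has \<open>u = 0\<close>; for \<open>t = 1\<close> the middle one has
  \<open>u = r\<^sub>3 div (r\<^sub>2 r\<^sub>2) \<le> r\<^sub>3 \<le> v\<close> and the smallest one has \<open>u = r\<^sub>2 r\<^sub>3 - 1\<close>, \<open>v = \<ell> + r\<^sub>2 + r\<^sub>3\<close>, where
  \<open>v < u\<close> is exactly the condition \<open>\<ell> < \<sigma>\<^sub>3 - \<sigma>\<^sub>1\<close>. The largest factor at \<open>t = 0\<close> has \<open>k\<close> equal to \<open>\<vartheta> - 1\<close>.\<close>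

section \<open>Digit sums of multiples of a base, with and without a borrow\<close>

lemma digit_sum_zero [simp]: "digit_sum g 0 = 0"
  by (simp add: digit_sum.simps)

lemma digit_sum_mult_add:
  assumes "1 < g" "d < g"
  shows "digit_sum g (g * n + d) = d + digit_sum g n"
proof (cases "g * n + d = 0")
  case True
  then show ?thesis using assms by auto
next
  case False
  then have "digit_sum g (g * n + d) = (g * n + d) mod g + digit_sum g ((g * n + d) div g)"
    using assms by (subst digit_sum.simps) simp
  then show ?thesis using assms by simp
qed

lemma digit_sum_mult:
  assumes "1 < g"
  shows "digit_sum g (g * n) = digit_sum g n"
  using digit_sum_mult_add[of g 0 n] assms by simp

lemma digit_sum_less:
  assumes "d < g"
  shows "digit_sum g d = d"
proof (cases "1 < g")
  case True
  then show ?thesis using digit_sum_mult_add[of g d 0] assms by simp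
next
  case False
  then have "d = 0" using assms by linarith
  then show ?thesis by simp
qed

lemma digit_sum_three_digits:
  assumes "1 < g" "d0 < g" "d1 < g" "d2 < g"
  shows "digit_sum g (g * (g * d2 + d1) + d0) = d0 + d1 + d2"
  using assms by (simp add: digit_sum_mult_add digit_sum_less)

text \<open>The outer factor \<open>n + 1\<close> only shifts digits. \<open>0 < v\<close> bounds
  the last digit; \<open>u \<le> v \<le> n\<close> bounds the other two and keeps the middle one
  nonnegative.\<close>

lemma digit_sum_mult_pred_no_borrow:
  assumes "k = u * (n + 1) + v + 1" "0 < v" "v \<le> n" "u \<le> v"
  shows "digit_sum (n + 1) ((n + 1) * (k * n + 1)) = n + 1"
proof -
  define w where "w = v - u"
  define h where "h = n + 1 - v"
  have w: "int w = int v - int u" and wl: "w < n + 1"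
    using assms by (auto simp: w_def)
  have h: "int h = int n + 1 - int v" and hl: "h < n + 1"
    using assms by (auto simp: h_def)
  have "int (k * n + 1) = int ((n + 1) * ((n + 1) * u + w) + h)"
    by (simp add: assms(1) w h algebra_simps)
  then have eq: "k * n + 1 = (n + 1) * ((n + 1) * u + w) + h" by linarith
  have "digit_sum (n + 1) ((n + 1) * (k * n + 1)) = h + w + u"
    unfolding eq using assms wl hl
    by (subst digit_sum_mult, simp, subst digit_sum_three_digits) auto
  then show ?thesis using w h by linarith
qed

lemma digit_sum_mult_pred_borrow:
  assumes "k = u * (n + 1) + v + 1" "0 < v" "v < u" "u \<le> n + 1"
  shows "digit_sum (n + 1) ((n + 1) * (k * n + 1)) = 2 * (n + 1) - 1"
proof -
  \<comment> \<open>After the borrow the digits are \<open>u - 1\<close>, \<open>w\<close> and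
    \<open>h\<close>; \<open>0 < v < u \<le> n + 1\<close> puts all three in range.\<close>
  define w where "w = n + 1 + v - u"
  define h where "h = n + 1 - v"
  have w: "int w = int n + 1 + int v - int u" and wl: "w < n + 1"
    using assms by (auto simp: w_def)
  have h: "int h = int n + 1 - int v" and hl: "h < n + 1"
    using assms by (auto simp: h_def)
  have u: "int (u - 1) = int u - 1" using assms by auto
  have "int (k * n + 1) = int ((n + 1) * ((n + 1) * (u - 1) + w) + h)"
    unfolding of_nat_add of_nat_mult w h u by (simp add: assms(1) algebra_simps)
  then have eq: "k * n + 1 = (n + 1) * ((n + 1) * (u - 1) + w) + h" by linarith
  have "digit_sum (n + 1) ((n + 1) * (k * n + 1)) = h + w + (u - 1)"
    unfolding eq using assms wl hl
    by (subst digit_sum_mult, simp, subst digit_sum_three_digits) auto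
  moreover have "int (h + w + (u - 1)) = int (2 * n + 1)" using w h u by simp
  then have "h + w + (u - 1) = 2 * n + 1" by (simp only: of_nat_eq_iff)
  ultimately show ?thesis by simp
qed

section \<open>Digit sums of the product in the bases given by its three factors\<close>

lemma mult_succ_eq_of_quotient:
  fixes a b c x k :: nat
  assumes "a + b + x * a * b = k * c"
  shows "(a * x + 1) * (b * x + 1) = k * (c * x) + 1"
proof -
  have "(a * x + 1) * (b * x + 1) = (a + b + x * a * b) * x + 1"
    by (simp add: algebra_simps)
  then show ?thesis unfolding assms by (simp add: mult.assoc)
qed

text \<open>As \<open>a\<close> and \<open>b\<close> are at most \<open>c - 1\<close>, the sum
  \<open>a + b + x * a * b\<close> is at most \<open>c * (c * x + 1)\<close>. So \<open>k\<close>
  does not exceed the base, and \<open>k - 1\<close> is a nonzero digit with quotient 0.\<close>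

lemma digit_sum_largest:
  fixes a b c x k :: nat
  assumes "a < b" "b < c" "0 < x" and k: "a + b + x * a * b = k * c" "2 \<le> k"
  shows "digit_sum (c * x + 1) ((a * x + 1) * (b * x + 1) * (c * x + 1)) = c * x + 1"
proof -
  obtain d where d: "c = Suc d" using assms(2) by (cases c) auto
  have "x * (a * b) \<le> x * (d * d)" using assms d by (intro mult_mono) auto
  moreover have "1 * d \<le> x * d" using assms(3) by (intro mult_right_mono) auto
  moreover have "(c * x + 1) * c = x * (d * d) + 2 * (x * d) + x + d + 1"
    by (simp add: d algebra_simps)
  ultimately have "a + b + x * a * b \<le> (c * x + 1) * c"
    using assms(1,2) d mult.assoc[of x a b] by linarith
  then have "k * c \<le> (c * x + 1) * c" by (simp only: k(1))
  then have "k \<le> c * x + 1" using mult_le_cancel2[of k c "c * x + 1"] assms(2) by linarith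
  then have "digit_sum (c * x + 1) ((c * x + 1) * (k * (c * x) + 1)) = c * x + 1"
    using k(2) by (intro digit_sum_mult_pred_no_borrow[where u = 0 and v = "k - 1"]) auto
  then show ?thesis
    unfolding mult_succ_eq_of_quotient[OF k(1)] by (simp only: mult.commute)
qed

text \<open>With \<open>r = c mod b^2\<close>, the remainder \<open>v\<close> of
  \<open>k - 1\<close> satisfies \<open>b * v = r * x\<close> up to lower-order terms, which
  \<open>b * c \<le> x\<close> controls. Coprimality and \<open>2 \<le> b\<close> make
  \<open>r\<close> nonzero, so \<open>v\<close> is at least \<open>c\<close>, hence at least
  \<open>u\<close>; \<open>r < b^2\<close> keeps \<open>v\<close> below the base.\<close>

lemma digit_sum_middle:
  fixes b c x :: nat
  assumes "2 \<le> b" "b < c" "coprime b c" "b * c \<le> x" and dvd: "b dvd 1 + c + x * c"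
  shows "digit_sum (b * x + 1) ((x + 1) * (b * x + 1) * (c * x + 1)) = b * x + 1"
proof -
  obtain k where k: "1 + c + x * c = k * b" using dvd by (metis dvd_def mult.commute)
  \<comment> \<open>\<open>k\<close> is about \<open>c * x / b\<close> and the base about
    \<open>b * x\<close>, so the quotient is about \<open>c / b^2\<close>.\<close>
  define u where "u = c div (b * b)"
  define r where "r = c mod (b * b)"
  have c: "c = u * (b * b) + r" unfolding u_def r_def by (rule div_mult_mod_eq[symmetric])
  have r0: "r \<noteq> 0"
  proof
    assume "r = 0"
    then have "b dvd c" using c by simp
    then show False using assms by auto
  qed
  have rl: "r + 1 \<le> b * b" using assms(1) by (simp add: r_def Suc_leI)
  \<comment> \<open>An integer, since the sign of this remainder is settled only by the estimates
    below.\<close>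
  define v where "v = int k - 1 - int u * int (b * x + 1)"
  have ci: "int c = int u * (int b * int b) + int r" by (subst c) simp
  have ki: "int k * int b = 1 + int c + int x * int c"
    by (metis k of_nat_1 of_nat_add of_nat_mult)
  have bv: "int b * v = int r * int x + 1 + int c - int b - int u * int b"
  proof -
    have "int b * v = int k * int b - int b - (int u * (int b * int b)) * int x - int u * int b"
      by (simp add: v_def algebra_simps)
    also have "int u * (int b * int b) = int c - int r" using ci by simp
    finally show ?thesis unfolding ki by (simp add: algebra_simps)
  qed
  have ub: "u * b \<le> c"
  proof -
    have "u * b * 1 \<le> u * b * b" using assms(1) by (intro mult_left_mono) auto
    then have "u * b \<le> u * (b * b)" by (simp only: mult_1_right mult.assoc)
    then show ?thesis using c by linarith
  qed
  have "u * 1 \<le> u * b" using assms(1) by (intro mult_left_mono) auto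
  with ub have uc: "u \<le> c" by linarith
  have "1 * (b * c) \<le> r * x" using r0 assms(4) by (intro mult_mono) auto
  then have "int b * int c \<le> int r * int x" by (metis mult_1 of_nat_le_iff of_nat_mult)
  moreover have ubi: "int u * int b \<le> int c" using ub by (metis of_nat_le_iff of_nat_mult)
  ultimately have "int b * (int c - 1) < int b * v"
    unfolding bv by (simp add: algebra_simps)
  then have vc: "int c \<le> v" using assms(1) by (simp add: mult_less_cancel_left)
  \<comment> \<open>The slack \<open>x\<close> between \<open>r * x\<close> and
    \<open>b^2 * x\<close> absorbs the term \<open>c\<close> in \<open>bv\<close>.\<close>
  have "(r + 1) * x \<le> b * b * x" using rl by (rule mult_right_mono) simp
  then have "int r * int x + int x \<le> int b * int b * int x"
    by (metis add.commute mult_1 distrib_right of_nat_add of_nat_le_iff of_nat_mult)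
  moreover have "1 * c \<le> b * c" using assms(1) by (intro mult_right_mono) auto
  with assms(4) have "int c \<le> int x" by linarith
  moreover have "0 \<le> int u * int b" by simp
  ultimately have "int b * v < int b * (int b * int x + 1)"
    unfolding bv distrib_left mult_1_right mult.assoc using assms(1) by linarith
  then have vl: "v \<le> int (b * x)" using assms(1) by (simp add: mult_less_cancel_left)
  have "int k = int (u * (b * x + 1) + nat v + 1)"
    using vc by (simp add: v_def algebra_simps)
  then have "k = u * (b * x + 1) + nat v + 1" by linarith
  then have "digit_sum (b * x + 1) ((b * x + 1) * (k * (b * x) + 1)) = b * x + 1"
    by (rule digit_sum_mult_pred_no_borrow) (use vc vl uc assms in linarith)+
  moreover have "(1 * x + 1) * (c * x + 1) = k * (b * x) + 1"
    by (rule mult_succ_eq_of_quotient) (use k in simp)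
  ultimately show ?thesis
    by (metis mult_1 mult.assoc mult.commute)
qed

text \<open>Here the first entry is 1, so \<open>k\<close> needs no division. Substituting
  \<open>x = b * c + l\<close> gives \<open>k - 1\<close> the quotient \<open>b * c - 1\<close> and
  the remainder \<open>l + b + c\<close>; the second hypothesis says that the remainder is smaller
  than the quotient, which forces the borrow.\<close>

lemma digit_sum_smallest:
  fixes b c l :: nat
  assumes "1 \<le> b" "l + 1 + b + c < b * c" and x: "x = b * c + l"
  shows "digit_sum (x + 1) ((x + 1) * (b * x + 1) * (c * x + 1)) = 2 * (x + 1) - 1"
proof -
  define k where "k = b + c + x * b * c"
  have u: "int (b * c - 1) = int b * int c - 1"
  proof -
    have "1 \<le> b * c" using assms(2) by linarith
    then show ?thesis by (simp add: of_nat_diff)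
  qed
  have "int k = int ((b * c - 1) * (x + 1) + (l + b + c) + 1)"
    unfolding of_nat_add of_nat_mult u by (simp add: k_def x algebra_simps)
  then have "k = (b * c - 1) * (x + 1) + (l + b + c) + 1" by linarith
  then have "digit_sum (x + 1) ((x + 1) * (k * x + 1)) = 2 * (x + 1) - 1"
    by (rule digit_sum_mult_pred_borrow) (use assms in linarith)+
  moreover have "(b * x + 1) * (c * x + 1) = k * (1 * x) + 1"
    by (rule mult_succ_eq_of_quotient) (simp add: k_def)
  ultimately show ?thesis by (simp only: mult.assoc mult_1)
qed

section \<open>Carmichael numbers with three prime factors\<close>

lemma fermat_theorem_int:
  fixes a :: int
  assumes "prime p" "\<not> int p dvd a"
  shows "[a ^ (p - 1) = 1] (mod int p)"
proof -
  define b where "b = nat (a mod int p)"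
  have b: "int b = a mod int p"
    using prime_gt_0_nat[OF assms(1)] by (simp add: b_def)
  have "\<not> p dvd b"
    using assms(2) b by (metis dvd_mod_iff dvd_refl of_nat_dvd_iff)
  then have "[b ^ (p - 1) = 1] (mod p)" using assms(1) by (rule fermat_theorem[rotated])
  then have "[int b ^ (p - 1) = 1] (mod int p)"
    by (metis cong_int_iff of_nat_1 of_nat_power)
  moreover have "[a ^ (p - 1) = int b ^ (p - 1)] (mod int p)"
    by (rule cong_pow) (simp add: b cong_def)
  ultimately show ?thesis by (rule cong_trans[rotated])
qed

text \<open>The sufficient direction of Korselt's criterion: Fermat's little theorem modulo each
  prime, raised to a power, then glued by coprimality of the moduli.\<close>

lemma carmichael_number_three_primes:
  fixes p q r m :: nat
  assumes "prime p" "prime q" "prime r" "p < q" "q < r" and m: "m = p * q * r"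
    and dvd: "p - 1 dvd m - 1" "q - 1 dvd m - 1" "r - 1 dvd m - 1"
  shows "carmichael_number m"
proof -
  have *: "[a ^ (m - 1) = 1] (mod int n)"
    if a: "coprime a (int m)" and n: "prime n" "n dvd m" "n - 1 dvd m - 1" for a n
  proof -
    have "coprime a (int n)" using a n(2) by (meson coprime_divisors dvd_refl of_nat_dvd_iff)
    then have "\<not> int n dvd a" using n(1)
      by (metis coprime_absorb_right coprime_commute not_prime_unit prime_nat_int_transfer)
    then have "[a ^ (n - 1) = 1] (mod int n)"
      using n(1) by (rule fermat_theorem_int[rotated])
    moreover obtain j where "m - 1 = (n - 1) * j" using n(3) by auto
    ultimately show ?thesis
      by (metis cong_pow power_mult power_one)
  qed
  have co: "coprime p q" "coprime p r" "coprime q r"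
    using assms by (auto intro: primes_coprime)
  have "[a ^ (m - 1) = 1] (mod int m)" if "coprime a (int m)" for a
  proof -
    have "[a ^ (m - 1) = 1] (mod int p)" "[a ^ (m - 1) = 1] (mod int q)"
      "[a ^ (m - 1) = 1] (mod int r)"
      using * that assms by auto
    then have "[a ^ (m - 1) = 1] (mod int p * int q * int r)"
      using co by (intro coprime_cong_mult) auto
    then show ?thesis by (simp add: m)
  qed
  moreover have "m > 1"
    unfolding m using assms prime_gt_1_nat by (metis less_1_mult)
  moreover have "\<not> prime m"
    unfolding m using assms by (metis less_1_mult less_not_refl prime_gt_1_nat prime_product)
  ultimately show ?thesis by (simp add: carmichael_number_def)
qed

section \<open>Products of three primes and their strict decompositions\<close>

lemma prime_factors_three_primes:
  fixes p q r :: nat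
  assumes "prime p" "prime q" "prime r"
  shows "prime_factors (p * q * r) = {p, q, r}"
proof -
  have "p \<noteq> 0" "q \<noteq> 0" "r \<noteq> 0" using assms by auto
  then show ?thesis using assms
    by (simp add: prime_factors_product prime_factorization_prime insert_commute)
qed

lemma proper_divisor_two_primes:
  fixes q r n n' :: nat
  assumes "prime q" "prime r" "n * n' = q * r" "n \<noteq> 1" "n' \<noteq> 1"
  shows "n = q \<or> n = r"
proof -
  have "q dvd n * n'" using assms(3) by simp
  then consider "q dvd n" | "q dvd n'" using assms(1) prime_dvd_mult_iff by blast
  then show ?thesis
  proof cases
    case 1
    then obtain j where j: "n = q * j" by auto
    then have "j * n' = r" using assms(1,3) by auto
    then show ?thesis using prime_product[of j n'] assms(2,5) j by auto
  next
    case 2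
    then obtain j where j: "n' = q * j" by auto
    then have "n * j = r" using assms(1,3) by auto
    then show ?thesis using prime_product[of n j] assms(2,4) j by auto
  qed
qed

text \<open>A proper divisor \<open>g\<close> of \<open>m\<close> that is a product of two of the primes exceeds its cofactor \<open>n\<close>,
  so \<open>m = g n\<close> has base-\<open>g\<close> digit sum \<open>n < g\<close>. Hence a strict decomposition only uses primes.\<close>

lemma strict_factor_prime:
  fixes p q r g m :: nat
  assumes "prime p" "prime q" "prime r" "q \<le> b" "r \<le> b" and m: "m = p * q * r"
    and b: "b\<^sup>2 < m" and g: "p dvd g" "g dvd m" "1 < g" "g < m" "digit_sum g m = g"
  shows "g = p"
proof (rule ccontr)
  assume "g \<noteq> p"
  obtain n where n: "m = g * n" using g(2) by auto
  obtain n' where n': "g = p * n'" using g(1) by auto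
  have "n * n' = q * r" using m assms(1) by (simp add: n n' mult_ac)
  moreover have "n \<noteq> 1" using n g by auto
  moreover have "n' \<noteq> 1" using n' \<open>g \<noteq> p\<close> by auto
  ultimately have "n = q \<or> n = r" using assms(2,3) by (rule proper_divisor_two_primes[rotated 2])
  then have nb: "n \<le> b" using assms by auto
  have "n < g"
  proof (rule ccontr)
    assume "\<not> n < g"
    then have "g * n \<le> b * b" using nb by (intro mult_mono) auto
    then show False using b by (simp add: n power2_eq_square)
  qed
  then have "digit_sum g m = n" using g(3) by (simp add: n digit_sum_mult digit_sum_less)
  then show False using g(5) \<open>n < g\<close> by simp
qed

text \<open>Each prime \<open>s\<close> of \<open>m\<close> divides some base of a strict
  decomposition. Since \<open>r\<^sup>2 < m\<close>, \<open>strict_factor_prime\<close> makes that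
  base equal to \<open>s\<close>, so strictness is the digit sum condition at
  \<open>s\<close>.\<close>

lemma primary_carmichael3_if_S_strict:
  fixes p q r m :: nat
  assumes "prime p" "prime q" "prime r" "p < q" "q < r" and m: "m = p * q * r"
    and "r\<^sup>2 < m" "m \<in> S_strict"
  shows "m \<in> primary_carmichael3"
proof -
  obtain D where D: "strict_s_decomposition D m" using assms by (auto simp: S_strict_def)
  then have prod: "m = (\<Prod>(g, e)\<leftarrow>D. g ^ e)"
    and D': "\<And>g e. (g, e) \<in> set D \<Longrightarrow> 1 < g \<and> g < m \<and> 1 \<le> e \<and> digit_sum g m = g"
    by (auto simp: strict_s_decomposition_def s_decomposition_def factor_decomposition_def)
  have dvd_m: "g dvd m" if "(g, e) \<in> set D" for g e
  proof -
    have "g ^ e \<in> set (map (\<lambda>(g, e). g ^ e) D)" using that by force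
    then have "g ^ e dvd m" unfolding prod by (rule prod_list_dvd)
    moreover have "g dvd g ^ e" using D'[OF that] by (simp add: dvd_power)
    ultimately show ?thesis by (rule dvd_trans[rotated])
  qed
  have factor: "\<exists>(g, e) \<in> set D. s dvd g" if "prime s" "s dvd m" for s
  proof -
    have "s dvd prod_list (map (\<lambda>(g, e). g ^ e) D)" using that(2) prod by simp
    then have "\<exists>z \<in> set D. s dvd (case z of (g, e) \<Rightarrow> g ^ e)"
      using that(1) by (induction D) (auto simp: prime_dvd_mult_iff)
    then show ?thesis using that(1) by (auto dest: prime_dvd_power)
  qed
  have main: "digit_sum s m = s"
    if s: "prime s" "prime s'" "prime s''" "s' \<le> r" "s'' \<le> r" "m = s * s' * s''" for s s' s''
  proof -
    have "s dvd m" unfolding s(6) by (simp add: mult.assoc)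
    then obtain g e where g: "(g, e) \<in> set D" "s dvd g"
      using factor[OF s(1)] by auto
    then have "g = s"
      using strict_factor_prime[of s s' s'' r m g] s assms(7) dvd_m[OF g(1)] D'[OF g(1)] by blast
    then show ?thesis using D'[OF g(1)] by simp
  qed
  have "digit_sum p m = p"
    by (rule main[of p q r]) (use assms(1-5) m in auto)
  moreover have "digit_sum q m = q"
    by (rule main[of q p r]) (use assms(1-5) m in auto)
  moreover have "digit_sum r m = r"
    by (rule main[of r p q]) (use assms(1-5) m in auto)
  moreover have pf: "prime_factors m = {p, q, r}"
    unfolding m by (rule prime_factors_three_primes) fact+
  moreover have "squarefree m"
    unfolding m using assms
    by (intro squarefree_mult_coprime) (auto intro: primes_coprime squarefree_prime)
  moreover have "1 < m"
    unfolding m using assms prime_gt_1_nat by (metis less_1_mult)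
  moreover have "s \<in> {p, q, r}" if "prime s" "s dvd m" for s
    using that pf \<open>1 < m\<close> by (metis in_prime_factors_iff less_nat_zero_code)
  ultimately show ?thesis
    using assms(4,5) by (auto simp: primary_carmichael3_def)
qed

section \<open>Consequences of the congruence defining \<open>ell\<close>\<close>

lemma sigma3_dvd_ell:
  assumes "r \<in> coprime_triples"
  shows "sigma3 r dvd sigma1 r + (sigma3 r * t + ell r) * sigma2 r"
proof -
  have "[int (ell r) * int (sigma2 r) = - int (sigma1 r)] (mod (int (sigma3 r)))"
    unfolding ell_def using theI'[OF ell_unique_exists[OF assms]] by blast
  then have "int (sigma3 r) dvd int (ell r) * int (sigma2 r) + int (sigma1 r)"
    by (simp add: cong_iff_dvd_diff)
  then have "sigma3 r dvd ell r * sigma2 r + sigma1 r"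
    by (metis of_nat_add of_nat_dvd_iff of_nat_mult)
  then have "sigma3 r dvd ell r * sigma2 r + sigma1 r + sigma3 r * (t * sigma2 r)"
    by (rule dvd_add) (rule dvd_triv_left)
  then show ?thesis by (simp add: algebra_simps)
qed

text \<open>Modulo \<open>c\<close>, only \<open>a + b + x * a * b\<close> survives of the given
  sum.\<close>

lemma dvd_quotient:
  fixes a b c x :: nat
  assumes "a * b * c dvd (a + b + c) + x * (a * b + a * c + b * c)"
  shows "c dvd a + b + x * a * b"
proof -
  have "c dvd (a + b + x * a * b) + c * (1 + x * (a + b))"
    using dvd_mult_right[OF assms] by (simp add: algebra_simps)
  then show ?thesis by (simp only: dvd_add_left_iff dvd_triv_left)
qed

text \<open>Expanding the product, every term of it minus 1 contains \<open>x\<close>, and the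
  cofactor is the hypothesis plus a multiple of \<open>a * b * c\<close>. This supplies Korselt's
  condition, as each factor minus 1 divides \<open>a * b * c * x\<close>.\<close>

lemma mult_dvd_prod_succ_minus_one:
  fixes a b c x :: nat
  assumes "a * b * c dvd (a + b + c) + x * (a * b + a * c + b * c)"
  shows "a * b * c * x dvd (a * x + 1) * (b * x + 1) * (c * x + 1) - 1"
proof -
  have "(a * x + 1) * (b * x + 1) * (c * x + 1) - 1 =
      ((a + b + c) + x * (a * b + a * c + b * c) + a * b * c * (x * x)) * x"
    by (simp add: algebra_simps)
  moreover have "a * b * c dvd (a + b + c) + x * (a * b + a * c + b * c) + a * b * c * (x * x)"
    by (rule dvd_add[OF assms]) simp
  ultimately show ?thesis by (simp only: mult_dvd_mono dvd_refl)
qed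

text \<open>Splitting off \<open>r3 / r3 = 1\<close> and cancelling one \<open>r3\<close> in the
  second summand leaves a fraction over \<open>r3\<close>, whose numerator is
  \<open>k * r3\<close>.\<close>

lemma theta_eq:
  assumes "0 < r3" "r1 + r2 + ell (r1, r2, r3) * r1 * r2 = k * r3"
  shows "theta (r1, r2, r3) = of_nat (k + 1)"
proof -
  have "theta (r1, r2, r3) = of_nat (r1 + r2 + ell (r1, r2, r3) * r1 * r2) / of_nat r3 + 1"
    using assms(1) by (simp add: field_simps power2_eq_square)
  then show ?thesis unfolding assms(2) using assms(1) by simp
qed

section \<open>Combination of the cases \<open>t = 0\<close> and \<open>t = 1\<close>\<close>

theorem theorem4p5:
  fixes r1 r2 r3 :: nat
  assumes "(r1, r2, r3) \<in> coprime_triples"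
  shows "theta (r1, r2, r3) \<in> \<int> \<and> theta (r1, r2, r3) \<ge> 2 \<and>
    (\<forall>t < tau (r1, r2, r3). \<forall>m g1 g2 g3.
       m = U (r1, r2, r3) t \<and>
       g1 = U_factor (r1, r2, r3) r1 t \<and>
       g2 = U_factor (r1, r2, r3) r2 t \<and>
       g3 = U_factor (r1, r2, r3) r3 t \<longrightarrow>
         (prime g1 \<and> odd g1 \<and> prime g2 \<and> odd g2 \<and> prime g3 \<and> odd g3 \<longrightarrow>
            carmichael_number m \<and> card (prime_factors m) = 3 \<and>
            (t = 0 \<and> m \<in> S_strict \<longrightarrow> m \<in> primary_carmichael3) \<and>
            (t = 1 \<longrightarrow> m \<notin> primary_carmichael3)) \<and>
         (t = 0 \<longrightarrow>
            (theta (r1, r2, r3) = 2 \<longrightarrow>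
               digit_sum g3 m < g3 \<and> m = g3\<^sup>2 \<and> g3 = g1 * g2) \<and>
            (theta (r1, r2, r3) > 2 \<longrightarrow>
               digit_sum g3 m = g3 \<and> m > g3\<^sup>2)) \<and>
         (t = 1 \<longrightarrow>
            m \<in> S_weak \<and>
            s_decomposition [(g1, 1), (g2, 1), (g3, 1)] m \<and>
            \<not> strict_s_decomposition [(g1, 1), (g2, 1), (g3, 1)] m \<and>
            digit_sum g1 m = 2 * g1 - 1 \<and> digit_sum g2 m = g2 \<and> digit_sum g3 m = g3))"
proof -
  define r where "r = (r1, r2, r3)"
  have r: "0 < r1" "r1 < r2" "r2 < r3" "coprime r2 r3" and rC: "r \<in> coprime_triples"
    using assms by (auto simp: coprime_triples_def r_def)
  have s1: "sigma1 r = r1 + r2 + r3" and s2: "sigma2 r = r1 * r2 + r1 * r3 + r2 * r3"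
    and s3: "sigma3 r = r1 * r2 * r3" by (simp_all add: r_def)
  define x where "x t = r1 * r2 * r3 * t + ell r" for t
  have dvd: "r1 * r2 * r3 dvd (r1 + r2 + r3) + x t * (r1 * r2 + r1 * r3 + r2 * r3)" for t
    using sigma3_dvd_ell[OF rC, of t] unfolding s1 s2 s3 x_def .
  have UF: "U_factor r y t = y * x t + 1" for y t
    by (simp add: U_factor_def x_def s3)
  have x0: "x 0 = ell r" by (simp add: x_def)
  obtain k where k: "r1 + r2 + x 0 * r1 * r2 = k * r3"
    using dvd_quotient[OF dvd[of 0]] by (metis dvd_def mult.commute)
  have theta: "theta r = of_nat (k + 1)"
    unfolding r_def by (rule theta_eq) (use r k x0 r_def in auto)
  have k1: "1 \<le> k"
  proof (rule ccontr)
    assume "\<not> 1 \<le> k"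
    then have "k * r3 = 0" by simp
    with k r show False by linarith
  qed
  have ge2: "theta r \<ge> 2" unfolding theta using k1 by simp
  \<comment> \<open>If \<open>ell r\<close> vanished, then \<open>r1 + r2\<close> would be at least
    \<open>2 * r3\<close>.\<close>
  have xpos: "0 < x 0" if "2 \<le> k"
  proof (rule ccontr)
    assume "\<not> 0 < x 0"
    then have "r1 + r2 = k * r3" using k by simp
    moreover have "2 * r3 \<le> k * r3" using that by (rule mult_right_mono) simp
    ultimately show False using r by simp
  qed
  have "(prime g1 \<and> odd g1 \<and> prime g2 \<and> odd g2 \<and> prime g3 \<and> odd g3 \<longrightarrow>
          carmichael_number m \<and> card (prime_factors m) = 3 \<and>
          (t = 0 \<and> m \<in> S_strict \<longrightarrow> m \<in> primary_carmichael3) \<and>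
          (t = 1 \<longrightarrow> m \<notin> primary_carmichael3)) \<and>
       (t = 0 \<longrightarrow>
          (theta r = 2 \<longrightarrow> digit_sum g3 m < g3 \<and> m = g3\<^sup>2 \<and> g3 = g1 * g2) \<and>
          (theta r > 2 \<longrightarrow> digit_sum g3 m = g3 \<and> m > g3\<^sup>2)) \<and>
       (t = 1 \<longrightarrow>
          m \<in> S_weak \<and>
          s_decomposition [(g1, 1), (g2, 1), (g3, 1)] m \<and>
          \<not> strict_s_decomposition [(g1, 1), (g2, 1), (g3, 1)] m \<and>
          digit_sum g1 m = 2 * g1 - 1 \<and> digit_sum g2 m = g2 \<and> digit_sum g3 m = g3)"
    if t: "t < tau r" and mU: "m = U r t" and gU: "g1 = U_factor r r1 t" "g2 = U_factor r r2 t" "g3 = U_factor r r3 t"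
    for t m g1 g2 g3
  proof -
    have g: "g1 = r1 * x t + 1" "g2 = r2 * x t + 1" "g3 = r3 * x t + 1" unfolding gU UF by simp_all
    have m: "m = g1 * g2 * g3" using mU gU by (simp add: r_def)
    have mx: "m = (r1 * x t + 1) * (r2 * x t + 1) * (r3 * x t + 1)" by (simp add: m g)
    have g_less: "g1 < g2" "g2 < g3" "1 < g1" if "0 < x t" using that r g by auto

    have zero_eq: "digit_sum g3 m < g3 \<and> m = g3\<^sup>2 \<and> g3 = g1 * g2"
      if "t = 0" "theta r = 2"
    proof -
      have "of_nat (k + 1) = (of_nat 2 :: rat)" using that(2) theta by simp
      then have "k = 1" by (simp only: of_nat_eq_iff)
      then have g12: "g3 = g1 * g2"
        using mult_succ_eq_of_quotient[OF k] \<open>t = 0\<close> by (simp add: g)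
      then have m2: "m = g3\<^sup>2" by (simp add: m power2_eq_square)
      have "digit_sum g3 m < g3"
      \<comment> \<open>For \<open>g3 > 1\<close>, the square of the base has digit sum 1. The base
        \<open>g3 = 1\<close> does occur, for instance for (1, 2, 3), where \<open>ell\<close> is 0;
        there the digit sum is 0 by convention.\<close>
      proof (cases "1 < g3")
        case True
        then show ?thesis
          using digit_sum_mult[OF True, of "g3 * 1"] digit_sum_mult[OF True, of 1]
          by (simp add: m2 power2_eq_square digit_sum_less)
      next
        case False
        then show ?thesis using g by (simp add: digit_sum.simps)
      qed
      with g12 m2 show ?thesis by simp
    qed

    have zero_gt: "digit_sum g3 m = g3 \<and> m > g3\<^sup>2 \<and> 0 < x t"
      if "t = 0" "theta r > 2"
    proof -
      have "of_nat (k + 1) > (of_nat 2 :: rat)" using that(2) theta by simp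
      then have k2: "2 \<le> k" unfolding of_nat_less_iff by simp
      have "1 * (r3 * x 0) < k * (r3 * x 0)"
        using k2 xpos[OF k2] r by (intro mult_strict_right_mono) auto
      then have "g3 < g1 * g2"
        using mult_succ_eq_of_quotient[OF k] \<open>t = 0\<close> by (simp add: g)
      then have "g3 * g3 < g1 * g2 * g3"
        using g(3) by (intro mult_strict_right_mono) auto
      moreover have "digit_sum g3 m = g3"
        unfolding mx g(3) \<open>t = 0\<close> using r k2 xpos[OF k2] k by (intro digit_sum_largest) auto
      ultimately show ?thesis using xpos[OF k2] that(1) by (simp add: m power2_eq_square)
    qed

    have one: "m \<in> S_weak \<and> s_decomposition [(g1, 1), (g2, 1), (g3, 1)] m \<and>
        \<not> strict_s_decomposition [(g1, 1), (g2, 1), (g3, 1)] m \<and>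
        digit_sum g1 m = 2 * g1 - 1 \<and> digit_sum g2 m = g2 \<and> digit_sum g3 m = g3 \<and> 0 < x t"
      if "t = 1"
    proof -
      \<comment> \<open>\<open>t = 1\<close> is below \<open>tau r\<close> only when
        \<open>tau r\<close> is 2, which yields both conditions.\<close>
      have r1: "r1 = 1" and "int (ell r) < int (sigma3 r) - int (sigma1 r)"
        using t that by (auto simp: r_def split: if_splits)
      then have l: "ell r + 1 + r2 + r3 < r2 * r3" using r1
        unfolding s1 s3 by (simp flip: of_nat_mult)
      have x1: "x t = r2 * r3 + ell r" by (simp add: x_def that r1)
      then have xp: "0 < x t" using l by linarith
      have m1: "m = (x t + 1) * (r2 * x t + 1) * (r3 * x t + 1)" using mx r1 by simp
      have ds1: "digit_sum g1 m = 2 * g1 - 1"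
        using digit_sum_smallest[OF _ l x1] r by (simp add: m1 g r1)
      have "r2 dvd r1 + r3 + x t * r1 * r3"
        by (rule dvd_quotient) (use dvd[of t] in \<open>simp add: ac_simps\<close>)
      then have ds2: "digit_sum g2 m = g2"
        unfolding m1 g(2) using r r1 x1 by (intro digit_sum_middle) auto
      obtain k' where k': "r1 + r2 + x t * r1 * r2 = k' * r3"
        using dvd_quotient[OF dvd[of t]] by (metis dvd_def mult.commute)
      \<comment> \<open>Unlike for \<open>t = 0\<close>, the quotient is always at least 2, because
        \<open>x t\<close> is at least \<open>r2 * r3\<close> and \<open>r2\<close> is at least
        2.\<close>
      have "2 * r3 \<le> (r2 * r3) * r2" using r by (intro order.trans[OF mult_mono[of 2 r2 r3 r3]]) auto
      also have "\<dots> \<le> x t * r2" unfolding x1 by (intro mult_right_mono) auto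
      also have "\<dots> \<le> k' * r3" unfolding k'[symmetric] r1 by simp
      finally have "2 \<le> k'" using r by simp
      then have ds3: "digit_sum g3 m = g3"
        unfolding mx g(3) using r xp k' by (intro digit_sum_largest) auto
      have "g3 < m" "g2 < m" "g1 < m"
      proof -
        have "1 * g3 < g1 * g2 * g3"
          using g_less[OF xp] by (intro mult_strict_right_mono less_1_mult) auto
        then show "g3 < m" by (simp add: m)
        then show "g2 < m" "g1 < m" using g_less[OF xp] by auto
      qed
      then have sd: "s_decomposition [(g1, 1), (g2, 1), (g3, 1)] m"
        using g_less[OF xp] ds1 ds2 ds3
        by (auto simp: s_decomposition_def factor_decomposition_def m)
      moreover have "\<not> strict_s_decomposition [(g1, 1), (g2, 1), (g3, 1)] m"
        using g_less[OF xp] ds1 by (auto simp: strict_s_decomposition_def)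
      moreover have "m \<in> S_weak" using sd \<open>g3 < m\<close> by (auto simp: S_weak_def)
      ultimately show ?thesis using ds1 ds2 ds3 xp by blast
    qed

    have primes: "carmichael_number m \<and> card (prime_factors m) = 3 \<and>
          (t = 0 \<and> m \<in> S_strict \<longrightarrow> m \<in> primary_carmichael3) \<and>
          (t = 1 \<longrightarrow> m \<notin> primary_carmichael3)"
      if p: "prime g1" "prime g2" "prime g3"
    proof -
      have "x t \<noteq> 0" using p(1) g(1) by (intro notI) auto
      then have xp: "0 < x t" by simp
      note gl = g_less[OF xp]
      have "r1 * r2 * r3 * x t dvd m - 1"
        unfolding mx by (rule mult_dvd_prod_succ_minus_one[OF dvd])
      moreover have "g1 - 1 dvd r1 * r2 * r3 * x t" "g2 - 1 dvd r1 * r2 * r3 * x t"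
        "g3 - 1 dvd r1 * r2 * r3 * x t"
        by (auto simp: g intro: mult_dvd_mono)
      ultimately have "carmichael_number m"
        using carmichael_number_three_primes[OF p gl(1,2) m] dvd_trans by blast
      moreover have "card (prime_factors m) = 3"
        unfolding m prime_factors_three_primes[OF p] using gl by simp
      moreover have "m \<in> primary_carmichael3" if "t = 0" "m \<in> S_strict"
      proof -
        \<comment> \<open>Primality of \<open>g3\<close> excludes \<open>theta r = 2\<close> through
          \<open>zero_eq\<close>, so \<open>zero_gt\<close> provides the bound
          \<open>g3\<^sup>2 < m\<close> needed for strict decompositions.\<close>
        have "g3 \<noteq> g1 * g2" using p gl by (metis less_not_refl prime_gt_1_nat prime_product)
        then have "theta r > 2" using ge2 zero_eq that by force
        then show ?thesis
          using primary_carmichael3_if_S_strict[OF p gl(1,2) m] zero_gt that by blast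
      qed
      moreover have "m \<notin> primary_carmichael3" if "t = 1"
      proof -
        \<comment> \<open>\<open>2 * g1 - 1\<close> differs from \<open>g1\<close> because
          \<open>g1 > 1\<close>.\<close>
        have "g1 dvd m" "digit_sum g1 m \<noteq> g1" using one[OF that] gl by (auto simp: m)
        then show ?thesis using p by (auto simp: primary_carmichael3_def)
      qed
      ultimately show ?thesis by blast
    qed
    show ?thesis using primes zero_eq zero_gt one by blast
  qed
  moreover have "theta r \<in> \<int>" unfolding theta by simp
  ultimately show ?thesis using ge2 unfolding r_def by blast
qed

end
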